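(* Let $\mathcal{C}$ be a partition of $\mathbb{E}^9$ into $13$ codes, each of minimum distance at least $4$. (i) If $\mathcal{C}$ contains a code $C$ that is the doubly extended Hamming code (up to equivalence under $G_9$) and $|\mathrm{Aut}(\mathcal{C})|\geq 2$, then there is a subgroup $H \leq \mathrm{Aut}(\mathcal{C})$ of prime order which is also a subgroup of $\mathrm{Aut}(C)$. (ii) If $|\mathrm{Aut}(\mathcal{C})|\geq 3$, then there is a subgroup $H \leq \mathrm{Aut}(\mathcal{C})$ whose order is $4$ or an odd prime such that $H\leq \mathrm{Aut}(C)$ for some code $C \in \mathcal{C}$.
   Context: $\mathbb{E}^n$ is the set of binary words of length $n$ with even Hamming weight; a code is a subset of $\mathbb{E}^n$, and its minimum distance is the smallest Hamming distance between two distinct codewords. $G_n$ is the group of all maps $\mathbb{E}^n\to\mathbb{E}^n$ of the form $x \mapsto \pi(x) + c$, where $\pi$ permutes the coordinates and $c \in \mathbb{E}^n$. For $g\in G_n$, $gC=\{gc: c\in C\}$ and $g\mathcal{C}=\{gC : C\in\mathcal{C}\}$; $\mathrm{Aut}(C)=\{g\in G_n : gC=C\}$, $\mathrm{Aut}(\mathcal{C})=\{g\in G_n : g\mathcal{C}=\mathcal{C}\}$. Two codes are equivalent if one is the image of the other under an element of $G_n$. A partition of $\mathbb{E}^n$ into codes is a set of pairwise disjoint codes with union $\mathbb{E}^n$. The Hamming code of length $7$ is the binary linear code of length $7$ and size $16$ with minimum distance $3$ (the null space of a $3\times 7$ binary matrix whose columns are the seven nonzero vectors of $\mathbb{F}_2^3$);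 the extended Hamming code is obtained by appending a parity bit to each codeword (an even code of length $8$, size $16$, minimum distance $4$), and the doubly extended Hamming code is obtained by further appending a $0$ to each codeword, giving an even code of length $9$, size $16$, minimum distance $4$. *)

theory Defs
  imports
    "HOL-Library.Z2"
    "HOL-Library.Extended_Nat"
    "HOL-Library.Disjoint_Sets"
    "HOL-Combinatorics.Permutations"
    "HOL-Computational_Algebra.Primes"
    "HOL-Algebra.Bij"
    "HOL-Algebra.Coset"
    "Jordan_Normal_Form.Matrix_Kernel"
begin

text \<open>Binary words of length \<open>n\<close> are the elements of \<open>carrier_vec n\<close> over the two-element field
  \<open>bit\<close>; coordinates are numbered from \<open>0\<close>.\<close>

definition hamming_dist :: "bit vec \<Rightarrow> bit vec \<Rightarrow> nat" where
  "hamming_dist x y = card {i. i < dim_vec x \<and> x $ i \<noteq> y $ i}"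

definition hamming_weight :: "bit vec \<Rightarrow> nat" where
  "hamming_weight x = card {i. i < dim_vec x \<and> x $ i \<noteq> 0}"

definition even_words :: "nat \<Rightarrow> bit vec set" where
  "even_words n = {x \<in> carrier_vec n. even (hamming_weight x)}"

text \<open>A code with fewer than two codewords has minimum distance \<open>\<infinity>\<close>.\<close>

definition min_distance :: "bit vec set \<Rightarrow> enat" where
  "min_distance C = Inf {enat (hamming_dist x y) | x y. x \<in> C \<and> y \<in> C \<and> x \<noteq> y}"

definition permute_word :: "(nat \<Rightarrow> nat) \<Rightarrow> bit vec \<Rightarrow> bit vec" where
  "permute_word \<pi> x = vec (dim_vec x) (\<lambda>i. x $ \<pi> i)"

text \<open>The maps are made extensional (\<open>undefined\<close> outside \<open>even_words n\<close>), so that distinct elements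
  of the set below are distinct maps on \<open>even_words n\<close> and they are elements of
  \<open>BijGroup (even_words n)\<close>.\<close>

definition symmetries :: "nat \<Rightarrow> (bit vec \<Rightarrow> bit vec) set" where
  "symmetries n =
    {\<lambda>x\<in>even_words n. permute_word \<pi> x + c | \<pi> c. \<pi> permutes {..<n} \<and> c \<in> even_words n}"

definition symmetry_group :: "nat \<Rightarrow> (bit vec \<Rightarrow> bit vec) monoid" where
  "symmetry_group n = (BijGroup (even_words n))\<lparr>carrier := symmetries n\<rparr>"

definition aut_code :: "nat \<Rightarrow> bit vec set \<Rightarrow> (bit vec \<Rightarrow> bit vec) monoid" where
  "aut_code n C = (symmetry_group n)\<lparr>carrier := {g \<in> symmetries n. g ` C = C}\<rparr>"

definition aut_family :: "nat \<Rightarrow> bit vec set set \<Rightarrow> (bit vec \<Rightarrow> bit vec) monoid" where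
  "aut_family n P = (symmetry_group n)\<lparr>carrier := {g \<in> symmetries n. (\<lambda>C. g ` C) ` P = P}\<rparr>"

definition equivalent_codes :: "nat \<Rightarrow> bit vec set \<Rightarrow> bit vec set \<Rightarrow> bool" where
  "equivalent_codes n C D \<longleftrightarrow> (\<exists>g \<in> symmetries n. g ` C = D)"

definition code_partition :: "nat \<Rightarrow> bit vec set set \<Rightarrow> bool" where
  "code_partition n P \<longleftrightarrow> disjoint P \<and> \<Union> P = even_words n"

text \<open>The order of the columns is left open; it only affects the code up to a permutation of the
  coordinates.\<close>

definition is_hamming_code_7 :: "bit vec set \<Rightarrow> bool" where
  "is_hamming_code_7 C \<longleftrightarrow>
    (\<exists>A \<in> carrier_mat 3 7. set (cols A) = carrier_vec 3 - {0\<^sub>v 3} \<and> C = mat_kernel A)"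

definition append_parity :: "bit vec \<Rightarrow> bit vec" where
  "append_parity x = x @\<^sub>v vec 1 (\<lambda>_. \<Sum>i<dim_vec x. x $ i)"

definition append_zero :: "bit vec \<Rightarrow> bit vec" where
  "append_zero x = x @\<^sub>v 0\<^sub>v 1"

definition is_doubly_extended_hamming :: "bit vec set \<Rightarrow> bool" where
  "is_doubly_extended_hamming C \<longleftrightarrow>
    (\<exists>D. is_hamming_code_7 D \<and> C = append_zero ` append_parity ` D)"

end

(*
  An even code of length 9 with minimum distance at least 4 has at most 20 words: for 21 words,
  summing the squares of the pairwise character correlations over ten coordinates (one of them
  dummy) gives at least 4500 by parity, and at most 4452 by the distances. Hence 13 codes covering
  the 256 even words cannot include two of size at most 16, as 16 + 16 + 11 * 20 = 252. A doubly
  extended Hamming code in the partition is therefore fixed by every automorphism, and Cauchy's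
  theorem gives (i). For (ii), a p-subgroup acting on the 13 codes without a fixed code would have
  p = 13 and act transitively, so that 13 would divide 256.
*)
theory Submission
  imports Defs "HOL-Algebra.Group_Action" "HOL-Algebra.Sylow"
begin

text \<open>Addition and multiplication of \<open>bit\<close> are kept as ring operations instead of
  being rewritten to bitwise ones, so that the laws for sums and vectors apply.\<close>

declare add_bit_eq_xor [simp del] mult_bit_eq_and [simp del]

section \<open>Even words and their symmetries\<close>

text \<open>Over the two-element field an entry equals the indicator of its being nonzero, so the
  sum of the entries is the weight modulo 2. Evenness thus becomes a linear condition.\<close>

lemma even_hamming_weight_iff: "even (hamming_weight x) \<longleftrightarrow> (\<Sum>i<dim_vec x. x $ i) = 0"
proof -
  have "(\<Sum>i<dim_vec x. x $ i) = (\<Sum>i<dim_vec x. of_bool (x $ i \<noteq> 0))"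
    by (rule sum.cong) auto
  also have "\<dots> = of_nat (hamming_weight x)"
    by (simp add: hamming_weight_def lessThan_def Int_def flip: sum.inter_filter)
  finally show ?thesis
    by (metis bit_not_zero_iff even_of_nat_iff even_zero odd_one)
qed

lemma even_words_iff:
  "x \<in> even_words n \<longleftrightarrow> x \<in> carrier_vec n \<and> (\<Sum>i<n. x $ i) = 0"
  by (auto simp: even_words_def even_hamming_weight_iff)

lemma even_words_carrier: "x \<in> even_words n \<Longrightarrow> x \<in> carrier_vec n"
  by (simp add: even_words_def)

lemma bit_add_self [simp]: "(a :: bit) + a = 0"
  by (cases a) auto

lemma bit_vec_add_self: "x \<in> carrier_vec n \<Longrightarrow> x + x = (0\<^sub>v n :: bit vec)"
  by auto

lemma zero_even_words: "0\<^sub>v n \<in> even_words n"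
  by (simp add: even_words_iff)

lemma add_even_words: "x \<in> even_words n \<Longrightarrow> y \<in> even_words n \<Longrightarrow> x + y \<in> even_words n"
  by (auto simp: even_words_iff sum.distrib)

lemma permute_word_carrier: "x \<in> carrier_vec n \<Longrightarrow> permute_word \<pi> x \<in> carrier_vec n"
  by (simp add: permute_word_def)

lemma permute_even_words:
  assumes "\<pi> permutes {..<n}" "x \<in> even_words n"
  shows "permute_word \<pi> x \<in> even_words n"
proof -
  have "(\<Sum>i<n. permute_word \<pi> x $ i) = (\<Sum>i<n. x $ \<pi> i)"
    using assms by (intro sum.cong) (auto simp: permute_word_def even_words_iff)
  also have "\<dots> = (\<Sum>i<n. x $ i)"
    using sum.permute[OF assms(1), of "\<lambda>i. x $ i"] by (simp add: o_def)
  finally show ?thesis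
    using assms by (auto simp: even_words_iff permute_word_def)
qed

lemma permute_word_add:
  assumes "\<pi> permutes {..<n}" "x \<in> carrier_vec n" "y \<in> carrier_vec n"
  shows "permute_word \<pi> (x + y) = permute_word \<pi> x + permute_word \<pi> y"
proof -
  have "\<pi> i < n" if "i < n" for i
    using permutes_in_image[OF assms(1), of i] that by simp
  then show ?thesis
    using assms(2-) by (intro eq_vecI) (simp_all add: permute_word_def)
qed

text \<open>Permuting a word precomposes it with the coordinate map, hence the order of the factors
  is reversed.\<close>

lemma permute_word_comp:
  assumes "\<pi> permutes {..<n}" "x \<in> carrier_vec n"
  shows "permute_word \<pi> (permute_word \<sigma> x) = permute_word (\<sigma> \<circ> \<pi>) x"
proof -
  have "\<pi> i < n" if "i < n" for i
    using permutes_in_image[OF assms(1), of i] that by simp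
  then show ?thesis
    using assms(2-) by (intro eq_vecI) (simp_all add: permute_word_def)
qed

lemma permute_word_id: "permute_word id x = x"
  by (auto simp: permute_word_def)

section \<open>The group of coordinate permutations followed by even translations\<close>

definition symmetry :: "nat \<Rightarrow> (nat \<Rightarrow> nat) \<Rightarrow> bit vec \<Rightarrow> bit vec \<Rightarrow> bit vec" where
  "symmetry n \<pi> c = (\<lambda>x\<in>even_words n. permute_word \<pi> x + c)"

lemma symmetries_eq:
  "symmetries n = {symmetry n \<pi> c | \<pi> c. \<pi> permutes {..<n} \<and> c \<in> even_words n}"
  by (simp add: symmetries_def symmetry_def)

lemma symmetry_closed:
  "\<pi> permutes {..<n} \<Longrightarrow> c \<in> even_words n \<Longrightarrow> x \<in> even_words n
    \<Longrightarrow> symmetry n \<pi> c x \<in> even_words n"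
  by (simp add: symmetry_def add_even_words permute_even_words)

text \<open>The semidirect product law: \<pi>(\<sigma>(x) + d) + c has the translation part \<pi>(d)
  + c.\<close>

lemma symmetry_compose:
  assumes "\<pi> permutes {..<n}" "c \<in> even_words n" "\<sigma> permutes {..<n}" "d \<in> even_words n"
  shows "compose (even_words n) (symmetry n \<pi> c) (symmetry n \<sigma> d) =
    symmetry n (\<sigma> \<circ> \<pi>) (permute_word \<pi> d + c)"
proof
  fix x
  show "compose (even_words n) (symmetry n \<pi> c) (symmetry n \<sigma> d) x =
    symmetry n (\<sigma> \<circ> \<pi>) (permute_word \<pi> d + c) x"
  proof (cases "x \<in> even_words n")
    case True
    have "permute_word \<pi> (permute_word \<sigma> x + d) + c
        = permute_word (\<sigma> \<circ> \<pi>) x + permute_word \<pi> d + c"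
      using True assms by (simp add: permute_word_add[of _ n] permute_word_comp[of _ n]
          permute_word_carrier even_words_carrier)
    also have "\<dots> = permute_word (\<sigma> \<circ> \<pi>) x + (permute_word \<pi> d + c)"
      using True assms by (intro assoc_add_vec[of _ n])
        (auto intro: permute_word_carrier even_words_carrier)
    finally show ?thesis
      using True assms
      by (simp add: compose_def symmetry_def add_even_words permute_even_words)
  qed (simp add: compose_def symmetry_def)
qed

text \<open>Solving y = \<pi>(x) + c for x applies the inverse permutation to y + c, since c is its
  own negative.\<close>

lemma symmetry_inverse:
  assumes "\<pi> permutes {..<n}" "c \<in> even_words n"
  shows "compose (even_words n) (symmetry n (inv_into UNIV \<pi>) (permute_word (inv_into UNIV \<pi>) c)) (symmetry n \<pi> c)
      = (\<lambda>x\<in>even_words n. x)"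
    and "compose (even_words n) (symmetry n \<pi> c) (symmetry n (inv_into UNIV \<pi>) (permute_word (inv_into UNIV \<pi>) c))
      = (\<lambda>x\<in>even_words n. x)"
proof -
  have inv: "inv_into UNIV \<pi> permutes {..<n}"
    using assms(1) by (rule permutes_inv)
  have id: "symmetry n id (0\<^sub>v n) = (\<lambda>x\<in>even_words n. x)"
    by (auto simp: symmetry_def permute_word_id even_words_carrier)
  have c: "c \<in> carrier_vec n"
    using assms even_words_carrier by blast
  show "compose (even_words n) (symmetry n (inv_into UNIV \<pi>) (permute_word (inv_into UNIV \<pi>) c)) (symmetry n \<pi> c)
      = (\<lambda>x\<in>even_words n. x)"
    using assms inv c
    by (simp add: symmetry_compose permute_even_words permutes_inv_o permute_word_carrier
        bit_vec_add_self[of _ n] id)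
  show "compose (even_words n) (symmetry n \<pi> c) (symmetry n (inv_into UNIV \<pi>) (permute_word (inv_into UNIV \<pi>) c))
      = (\<lambda>x\<in>even_words n. x)"
    using assms inv c
    by (simp add: symmetry_compose permute_even_words permutes_inv_o permute_word_carrier
        permute_word_comp[of _ n] permute_word_id bit_vec_add_self[of _ n] id)
qed

lemma symmetry_Bij:
  assumes "\<pi> permutes {..<n}" "c \<in> even_words n"
  shows "symmetry n \<pi> c \<in> Bij (even_words n)"
proof -
  have inv: "inv_into UNIV \<pi> permutes {..<n}"
    using assms(1) by (rule permutes_inv)
  let ?h = "symmetry n (inv_into UNIV \<pi>) (permute_word (inv_into UNIV \<pi>) c)"
  have "?h (symmetry n \<pi> c x) = x" if "x \<in> even_words n" for x
    using fun_cong[OF symmetry_inverse(1)[OF assms], of x] that by (simp add: compose_def)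
  moreover have "symmetry n \<pi> c (?h x) = x" if "x \<in> even_words n" for x
    using fun_cong[OF symmetry_inverse(2)[OF assms], of x] that by (simp add: compose_def)
  ultimately have "bij_betw (symmetry n \<pi> c) (even_words n) (even_words n)"
    using symmetry_closed[OF assms] symmetry_closed[OF inv permute_even_words[OF inv assms(2)]]
    by (intro bij_betw_byWitness[where f' = ?h]) blast+
  then show ?thesis
    by (simp add: Bij_def symmetry_def)
qed

lemma symmetries_subset_Bij: "symmetries n \<subseteq> Bij (even_words n)"
  by (auto simp: symmetries_eq intro: symmetry_Bij)

text \<open>Closure is read off from the explicit formulas for composites and inverses; the group
  axioms are inherited from \<open>BijGroup\<close>.\<close>

lemma subgroup_symmetries: "subgroup (symmetries n) (BijGroup (even_words n))"
proof
  show "symmetries n \<subseteq> carrier (BijGroup (even_words n))"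
    using symmetries_subset_Bij by (simp add: BijGroup_def)
next
  fix g h assume gh: "g \<in> symmetries n" "h \<in> symmetries n"
  then have "compose (even_words n) g h \<in> symmetries n"
    unfolding symmetries_eq
    by (smt (verit, best) add_even_words mem_Collect_eq permute_even_words permutes_compose
        symmetry_compose)
  then show "g \<otimes>\<^bsub>BijGroup (even_words n)\<^esub> h \<in> symmetries n"
    using gh symmetries_subset_Bij by (auto simp: BijGroup_def)
next
  have "symmetry n id (0\<^sub>v n) = (\<lambda>x\<in>even_words n. x)"
    by (auto simp: symmetry_def permute_word_id even_words_carrier)
  then show "\<one>\<^bsub>BijGroup (even_words n)\<^esub> \<in> symmetries n"
    unfolding symmetries_eq BijGroup_def using zero_even_words permutes_id
    by (metis (mono_tags, lifting) mem_Collect_eq monoid.select_convs(2))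
next
  fix g assume "g \<in> symmetries n"
  then obtain \<pi> c where g: "g = symmetry n \<pi> c" and \<pi>: "\<pi> permutes {..<n}" and c: "c \<in> even_words n"
    by (auto simp: symmetries_eq)
  let ?h = "symmetry n (inv_into UNIV \<pi>) (permute_word (inv_into UNIV \<pi>) c)"
  have h: "inv_into UNIV \<pi> permutes {..<n}" "permute_word (inv_into UNIV \<pi>) c \<in> even_words n"
    using permutes_inv[OF \<pi>] permute_even_words[OF permutes_inv[OF \<pi>] c] by simp_all
  have "inv\<^bsub>BijGroup (even_words n)\<^esub> g = ?h"
    unfolding g using symmetry_Bij[OF \<pi> c] symmetry_Bij[OF h]
    by (intro group.inv_equality[OF group_BijGroup])
      (simp_all add: BijGroup_def symmetry_inverse(1)[OF \<pi> c])
  then show "inv\<^bsub>BijGroup (even_words n)\<^esub> g \<in> symmetries n"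
    unfolding symmetries_eq using h by blast
qed

lemma group_symmetry_group: "group (symmetry_group n)"
  unfolding symmetry_group_def
  by (rule group.subgroup_imp_group[OF group_BijGroup subgroup_symmetries])

lemma carrier_symmetry_group [simp]: "carrier (symmetry_group n) = symmetries n"
  by (simp add: symmetry_group_def)

section \<open>Stabilizers of codes and of partitions\<close>

lemma image_symmetry_mult:
  assumes "g \<in> symmetries n" "h \<in> symmetries n" "C \<subseteq> even_words n"
  shows "(g \<otimes>\<^bsub>symmetry_group n\<^esub> h) ` C = g ` h ` C"
proof -
  \<comment> \<open>The product is composition cut off outside \<open>even_words n\<close>, so it
    acts as ordinary composition on codes inside that set.\<close>
  have "g \<otimes>\<^bsub>symmetry_group n\<^esub> h = compose (even_words n) g h"
    using assms symmetries_subset_Bij by (auto simp: symmetry_group_def BijGroup_def)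
  then show ?thesis
    using assms(3) by (auto simp: compose_def image_image intro!: image_cong)
qed

lemma image_symmetry_one:
  assumes "C \<subseteq> even_words n"
  shows "\<one>\<^bsub>symmetry_group n\<^esub> ` C = C"
  using assms by (auto simp: symmetry_group_def BijGroup_def)

lemma image_symmetry_inv:
  assumes "g \<in> symmetries n" "C \<subseteq> even_words n"
  shows "(inv\<^bsub>symmetry_group n\<^esub> g) ` g ` C = C"
proof -
  interpret group "symmetry_group n"
    by (rule group_symmetry_group)
  show ?thesis
    using assms image_symmetry_mult[of "inv\<^bsub>symmetry_group n\<^esub> g" n g C] inv_closed[of g]
    by (simp add: image_symmetry_one)
qed

lemma subgroup_aut_code:
  assumes "C \<subseteq> even_words n"
  shows "subgroup {g \<in> symmetries n. g ` C = C} (symmetry_group n)"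
proof -
  interpret group "symmetry_group n"
    by (rule group_symmetry_group)
  show ?thesis
  proof
    fix g assume g: "g \<in> {g \<in> symmetries n. g ` C = C}"
    then show "inv\<^bsub>symmetry_group n\<^esub> g \<in> {g \<in> symmetries n. g ` C = C}"
      using assms image_symmetry_inv[of g n C] inv_closed[of g] by auto
  qed (use assms m_closed one_closed in \<open>auto simp: image_symmetry_mult image_symmetry_one\<close>)
qed

lemma subgroup_aut_family:
  assumes "\<Union> P \<subseteq> even_words n"
  shows "subgroup {g \<in> symmetries n. (\<lambda>C. g ` C) ` P = P} (symmetry_group n)"
proof -
  interpret group "symmetry_group n"
    by (rule group_symmetry_group)
  have sub: "C \<subseteq> even_words n" if "C \<in> P" for C
    using assms that by auto
  show ?thesis
  proof
    fix g h
    assume gh: "g \<in> {g \<in> symmetries n. (\<lambda>C. g ` C) ` P = P}"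
      "h \<in> {g \<in> symmetries n. (\<lambda>C. g ` C) ` P = P}"
    have "(\<lambda>C. (g \<otimes>\<^bsub>symmetry_group n\<^esub> h) ` C) ` P = (\<lambda>C. g ` h ` C) ` P"
      using gh sub by (intro image_cong refl image_symmetry_mult) auto
    also have "\<dots> = (\<lambda>C. g ` C) ` (\<lambda>C. h ` C) ` P"
      by (rule image_image[symmetric])
    finally show "g \<otimes>\<^bsub>symmetry_group n\<^esub> h \<in> {g \<in> symmetries n. (\<lambda>C. g ` C) ` P = P}"
      using gh m_closed by simp
  next
    have "(\<lambda>C. \<one>\<^bsub>symmetry_group n\<^esub> ` C) ` P = P"
      using sub by (simp add: image_symmetry_one)
    then show "\<one>\<^bsub>symmetry_group n\<^esub> \<in> {g \<in> symmetries n. (\<lambda>C. g ` C) ` P = P}"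
      using one_closed by simp
  next
    fix g assume g: "g \<in> {g \<in> symmetries n. (\<lambda>C. g ` C) ` P = P}"
    let ?h = "inv\<^bsub>symmetry_group n\<^esub> g"
    have "(\<lambda>C. ?h ` C) ` P = (\<lambda>C. ?h ` C) ` (\<lambda>C. g ` C) ` P"
      using g by simp
    also have "\<dots> = (\<lambda>C. ?h ` g ` C) ` P"
      by (rule image_image)
    also have "\<dots> = (\<lambda>C. C) ` P"
      using g sub by (intro image_cong refl image_symmetry_inv) auto
    also have "\<dots> = P"
      by simp
    finally show "?h \<in> {g \<in> symmetries n. (\<lambda>C. g ` C) ` P = P}"
      using g inv_closed[of g] by simp
  qed auto
qed

lemma group_aut_family:
  assumes "\<Union> P \<subseteq> even_words n"
  shows "group (aut_family n P)"
  unfolding aut_family_def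
  by (rule group.subgroup_imp_group[OF group_symmetry_group subgroup_aut_family[OF assms]])

text \<open>Both automorphism groups carry the operation of \<open>symmetry_group n\<close>, so
  moving H from one to the other only compares carriers. Both parts of the theorem conclude in this
  way.\<close>

lemma subgroup_aut_codeI:
  assumes "\<Union> P \<subseteq> even_words n" and "C \<in> P"
    and H: "subgroup H (aut_family n P)" and fixed: "\<And>g. g \<in> H \<Longrightarrow> g ` C = C"
  shows "subgroup H (aut_code n C)"
proof -
  interpret group "symmetry_group n"
    by (rule group_symmetry_group)
  have H': "subgroup H (symmetry_group n)"
    using incl_subgroup[OF subgroup_aut_family[OF assms(1)]] H by (simp add: aut_family_def)
  have C: "C \<subseteq> even_words n"
    using assms by auto
  show ?thesis
    unfolding aut_code_def using subgroup.subset[OF H'] fixed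
    by (intro subgroup_incl[OF H' subgroup_aut_code[OF C]]) auto
qed

text \<open>Makes orbits and stabilizers available for the codes of the partition. The maps are
  restricted to P because elements of \<open>BijGroup P\<close> are extensional.\<close>

lemma aut_family_action:
  assumes P: "\<Union> P \<subseteq> even_words n"
  shows "group_action (aut_family n P) P (\<lambda>g. \<lambda>C\<in>P. g ` C)"
proof -
  have sub: "C \<subseteq> even_words n" if "C \<in> P" for C
    using P that by auto
  have bij: "(\<lambda>C\<in>P. g ` C) \<in> Bij P" if "g \<in> carrier (aut_family n P)" for g
  proof -
    have g: "g \<in> symmetries n" "(\<lambda>C. g ` C) ` P = P"
      using that by (auto simp: aut_family_def)
    \<comment> \<open>Taking images under the group inverse undoes the map; surjectivity onto P is
      the defining property of g.\<close>
    have "inj_on (\<lambda>C. g ` C) P"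
      by (rule inj_on_inverseI[where g = "\<lambda>C. (inv\<^bsub>symmetry_group n\<^esub> g) ` C"])
        (simp add: image_symmetry_inv g sub)
    then show ?thesis
      using g by (auto simp: Bij_def bij_betw_def inj_on_def)
  qed
  have "(\<lambda>C\<in>P. (g \<otimes>\<^bsub>aut_family n P\<^esub> h) ` C) =
      (\<lambda>C\<in>P. g ` C) \<otimes>\<^bsub>BijGroup P\<^esub> (\<lambda>C\<in>P. h ` C)"
    if "g \<in> carrier (aut_family n P)" "h \<in> carrier (aut_family n P)" for g h
  proof -
    have "g \<in> symmetries n" "h \<in> symmetries n" "(\<lambda>C. h ` C) ` P = P"
      using that by (auto simp: aut_family_def)
    then have "h ` C \<in> P" "(g \<otimes>\<^bsub>aut_family n P\<^esub> h) ` C = g ` h ` C" if "C \<in> P" for C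
      using that sub[OF that] by (auto simp: aut_family_def image_symmetry_mult)
    then have "(\<lambda>C\<in>P. (g \<otimes>\<^bsub>aut_family n P\<^esub> h) ` C) =
        compose P (\<lambda>C\<in>P. g ` C) (\<lambda>C\<in>P. h ` C)"
      by (simp add: compose_def restrict_def fun_eq_iff)
    then show ?thesis
      using bij that by (simp add: BijGroup_def)
  qed
  moreover have "(\<lambda>C\<in>P. g ` C) \<in> carrier (BijGroup P)" if "g \<in> carrier (aut_family n P)" for g
    using bij[OF that] by (simp add: BijGroup_def)
  ultimately have "(\<lambda>g. \<lambda>C\<in>P. g ` C) \<in> hom (aut_family n P) (BijGroup P)"
    by (auto simp: hom_def)
  then show ?thesis
    unfolding group_action_def group_hom_def group_hom_axioms_def
    using group_aut_family[OF P] group_BijGroup by blast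
qed

section \<open>Fixed points of prime power groups\<close>

text \<open>By the orbit-stabilizer theorem the size of an orbit is a power of p, and it is 1 only
  at a fixed point.\<close>

lemma (in group_action) card_orbit_prime_power:
  assumes "prime p" "Coset.order G = p ^ a" "x \<in> E" "\<not> (\<forall>g\<in>carrier G. \<phi> g x = x)"
  shows "p dvd card (orbit G \<phi> x)"
proof -
  interpret group G
    using group_hom group_hom.axioms(1) by auto
  have "card (orbit G \<phi> x) dvd p ^ a"
    using orbit_stabilizer_theorem[OF assms(3)] assms(2) by (metis dvd_triv_left)
  then obtain k where k: "card (orbit G \<phi> x) = p ^ k"
    using divides_primepow_nat[OF assms(1)] by blast
  have "k \<noteq> 0"
  proof
    assume "k = 0"
    with k obtain y where "orbit G \<phi> x = {y}"
      by (auto simp: card_1_singleton_iff)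
    with orbit_refl[OF assms(3)] have "orbit G \<phi> x = {x}"
      by auto
    with assms(4) show False
      by (auto simp: orbit_def)
  qed
  with k show ?thesis
    by simp
qed

text \<open>The orbits partition E; without fixed points each has size divisible by p, and so would
  E.\<close>

lemma (in group_action) fixed_point_prime_power:
  assumes "prime p" "Coset.order G = p ^ a" "finite E" "\<not> p dvd card E"
  shows "\<exists>x\<in>E. \<forall>g\<in>carrier G. \<phi> g x = x"
proof (rule ccontr)
  assume none: "\<not> (\<exists>x\<in>E. \<forall>g\<in>carrier G. \<phi> g x = x)"
  have "card E = (\<Sum>orb\<in>orbits G E \<phi>. card orb)"
    using disjoint_sum[OF assms(3), of "\<lambda>_. 1 :: nat"] by simp
  moreover have "p dvd card orb" if "orb \<in> orbits G E \<phi>" for orb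
    using that none card_orbit_prime_power[OF assms(1,2)] unfolding orbits_def by blast
  ultimately show False
    using assms(4) by (simp add: dvd_sum)
qed

text \<open>A number without odd prime factors is a power of 2, and one that is at least 3 has
  exponent at least 2.\<close>

lemma four_or_odd_prime_dvd:
  fixes n :: nat
  assumes "n \<ge> 3"
  shows "4 dvd n \<or> (\<exists>p. prime p \<and> odd p \<and> p dvd n)"
proof (cases "\<exists>p. prime p \<and> odd p \<and> p dvd n")
  case False
  have "q = 2" if "q \<in> prime_factors n" for q
    using False that primes_dvd_imp_eq[of 2 q] by (auto simp: in_prime_factors_iff)
  then obtain k where n: "n = 2 ^ k"
    using Ex_other_prime_factor[of n 2] assms by auto
  have "k \<ge> 2"
  proof (rule ccontr)
    assume "\<not> k \<ge> 2"
    then have "k = 0 \<or> k = 1"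
      by auto
    with assms n show False
      by auto
  qed
  then have "2 ^ 2 dvd (2 ^ k :: nat)"
    by (rule le_imp_power_dvd)
  with n show ?thesis
    by simp
qed auto

section \<open>Cardinalities\<close>

text \<open>A word corresponds to its support, and even weight to even cardinality. A nonempty set
  has as many even as odd subsets.\<close>

lemma finite_carrier_vec_bit: "finite (carrier_vec n :: bit vec set)"
  and card_carrier_vec_bit: "card (carrier_vec n :: bit vec set) = 2 ^ n"
  and card_even_words: "n > 0 \<Longrightarrow> card (even_words n) = 2 ^ (n - 1)"
proof -
  let ?f = "\<lambda>x :: bit vec. {i. i < n \<and> x $ i \<noteq> 0}"
  let ?g = "\<lambda>S. vec n (\<lambda>i. of_bool (i \<in> S)) :: bit vec"
  have gf: "?g (?f x) = x" if "x \<in> carrier_vec n" for x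
    using that by (auto simp: of_bool_def)
  have fg: "?f (?g S) = S" if "S \<subseteq> {..<n}" for S
    using that by auto
  have bij: "bij_betw ?f (carrier_vec n) (Pow {..<n})"
    by (rule bij_betw_byWitness[where f' = ?g]) (use gf fg in auto)
  show "finite (carrier_vec n :: bit vec set)"
    using bij_betw_finite[OF bij] by simp
  show "card (carrier_vec n :: bit vec set) = 2 ^ n"
    using bij_betw_same_card[OF bij] by (simp add: card_Pow)
  assume "n > 0"
  \<comment> \<open>The conjunct \<open>{} \<subseteq> S\<close> gives the family the shape counted
    by \<open>card_subsupersets_even_odd\<close>.\<close>
  have "bij_betw ?f (even_words n) {S. {} \<subseteq> S \<and> S \<subseteq> {..<n} \<and> even (card S)}"
  proof (rule bij_betw_byWitness[where f' = ?g])
    show "?f ` even_words n \<subseteq> {S. {} \<subseteq> S \<and> S \<subseteq> {..<n} \<and> even (card S)}"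
      by (auto simp: even_words_def hamming_weight_def)
    show "?g ` {S. {} \<subseteq> S \<and> S \<subseteq> {..<n} \<and> even (card S)} \<subseteq> even_words n"
      using fg by (auto simp: even_words_def hamming_weight_def)
  qed (use gf fg even_words_carrier in auto)
  then have even: "card (even_words n) = card {S. {} \<subseteq> S \<and> S \<subseteq> {..<n} \<and> even (card S)}"
    by (rule bij_betw_same_card)
  have odd: "card {S. {} \<subseteq> S \<and> S \<subseteq> {..<n} \<and> even (card S)}
      = card {S. {} \<subseteq> S \<and> S \<subseteq> {..<n} \<and> odd (card S)}"
  proof -
    have "{} \<subset> {..<n}"
      using \<open>n > 0\<close> by auto
    from card_subsupersets_even_odd[OF finite_lessThan this] show ?thesis
      by simp
  qed
  have "Pow {..<n} = {S. {} \<subseteq> S \<and> S \<subseteq> {..<n} \<and> even (card S)}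
      \<union> {S. {} \<subseteq> S \<and> S \<subseteq> {..<n} \<and> odd (card S)}"
    by auto
  also have "card \<dots> = 2 * card {S. {} \<subseteq> S \<and> S \<subseteq> {..<n} \<and> even (card S)}"
    by (subst card_Un_disjoint) (use odd in auto)
  finally have "2 ^ n = 2 * card (even_words n)"
    by (simp add: card_Pow even)
  with \<open>n > 0\<close> show "card (even_words n) = 2 ^ (n - 1)"
    by (cases n) auto
qed

lemma finite_even_words: "finite (even_words n)"
  by (rule finite_subset[OF _ finite_carrier_vec_bit[of n]]) (auto simp: even_words_carrier)

text \<open>A matrix whose columns comprise all nonzero vectors is onto, with preimages that may be chosen
  among the unit vectors.\<close>

lemma card_mat_kernel_le:
  fixes A :: "bit mat"
  assumes A: "A \<in> carrier_mat r n" and cols: "carrier_vec r - {0\<^sub>v r} \<subseteq> set (cols A)"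
  shows "card (mat_kernel A) * 2 ^ r \<le> 2 ^ n"
proof -
  have "\<exists>w \<in> carrier_vec n. A *\<^sub>v w = v" if "v \<in> carrier_vec r" for v
  proof (cases "v = 0\<^sub>v r")
    case True
    then show ?thesis
      using A by (intro bexI[of _ "0\<^sub>v n"]) auto
  next
    case False
    with that cols obtain j where j: "j < n" "v = col A j"
      using A by (auto simp: in_set_conv_nth subset_iff)
    \<comment> \<open>Multiplying A by the j-th unit vector yields its column j, which is v.\<close>
    then show ?thesis
      using A by (intro bexI[of _ "unit_vec n j"]) auto
  qed
  then obtain s where s: "s v \<in> carrier_vec n" "A *\<^sub>v s v = v" if "v \<in> carrier_vec r" for v
    by metis
  \<comment> \<open>Here \<open>s\<close> is a section of A. From k + s v the matrix recovers v, and
    then k is determined, so the pairs inject into the words of length n.\<close>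
  let ?f = "\<lambda>(k, v). k + s v"
  have val: "A *\<^sub>v (k + s v) = v" if "k \<in> mat_kernel A" "v \<in> carrier_vec r" for k v
    using that s mat_kernelD[OF A] by (simp add: mult_add_distrib_mat_vec[OF A])
  have "inj_on ?f (mat_kernel A \<times> carrier_vec r)"
  proof (rule inj_onI, clarify)
    fix k v k' v'
    assume *: "k \<in> mat_kernel A" "v \<in> carrier_vec r" "k' \<in> mat_kernel A" "v' \<in> carrier_vec r"
      and eq: "k + s v = k' + s v'"
    then have v: "v = v'"
      using val by metis
    have k: "k + s v = k' + s v" "k \<in> carrier_vec n" "k' \<in> carrier_vec n" "s v \<in> carrier_vec n"
      using eq v * s mat_kernelD[OF A] by auto
    have "k $ i = k' $ i" if "i < n" for i
    proof -
      have "(k + s v) $ i = (k' + s v) $ i"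
        using k by simp
      \<comment> \<open>Adding the entry of \<open>s v\<close> a second time cancels it in
        characteristic 2.\<close>
      then have "k $ i + s v $ i + s v $ i = k' $ i + s v $ i + s v $ i"
        using k(2-) that by simp
      then show ?thesis
        by (simp only: add.assoc bit_add_self add_0_right)
    qed
    then have "k = k'"
      using k by (intro eq_vecI) auto
    with v show "k = k' \<and> v = v'"
      by simp
  qed
  moreover have "?f ` (mat_kernel A \<times> carrier_vec r) \<subseteq> carrier_vec n"
    using s mat_kernelD[OF A] by auto
  ultimately have "card (mat_kernel A \<times> (carrier_vec r :: bit vec set)) \<le> card (carrier_vec n :: bit vec set)"
    using finite_carrier_vec_bit by (rule card_inj_on_le)
  then show ?thesis
    by (simp add: card_cartesian_product card_carrier_vec_bit)
qed

text \<open>The kernel has at most 2^7 / 2^3 = 16 words, and taking images does not increase the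
  size. The later count uses this upper bound.\<close>

lemma doubly_extended_hamming_card_le:
  assumes "is_doubly_extended_hamming D"
  shows "finite D" "card D \<le> 16"
proof -
  obtain A where A: "A \<in> carrier_mat 3 7" "set (cols A) = carrier_vec 3 - {0\<^sub>v 3}"
    and D: "D = append_zero ` append_parity ` mat_kernel A"
    using assms by (auto simp: is_doubly_extended_hamming_def is_hamming_code_7_def)
  have fin: "finite (mat_kernel A)"
    by (rule finite_subset[OF mat_kernel_carrier[OF A(1)] finite_carrier_vec_bit])
  then show "finite D"
    by (simp add: D)
  have "card (mat_kernel A) \<le> 16"
    using card_mat_kernel_le[OF A(1)] A(2) by simp
  then show "card D \<le> 16"
    using fin by (simp add: D image_image) (meson card_image_le le_trans)
qed

section \<open>The size of an even code of length 9 and minimum distance 4\<close>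

text \<open>Two bits differ exactly when their sum is nonzero.\<close>

lemma hamming_dist_add:
  assumes "x \<in> carrier_vec n" "y \<in> carrier_vec n"
  shows "hamming_dist x y = hamming_weight (x + y)"
proof -
  have add_zero: "a + b = 0 \<longleftrightarrow> a = b" for a b :: bit
    by (cases a; cases b) auto
  have "(i < dim_vec x \<and> x $ i \<noteq> y $ i) = (i < dim_vec (x + y) \<and> (x + y) $ i \<noteq> 0)" for i
  proof (cases "i < n")
    case True
    then have "(x + y) $ i = x $ i + y $ i"
      using assms by simp
    then show ?thesis
      using assms by (simp only: add_zero index_add_vec carrier_vecD)
  qed (use assms in simp)
  then show ?thesis
    unfolding hamming_dist_def hamming_weight_def by presburger
qed

lemma even_hamming_dist:
  assumes "x \<in> even_words n" "y \<in> even_words n"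
  shows "even (hamming_dist x y)"
  using add_even_words[OF assms] assms
  by (simp add: hamming_dist_add[of _ n] even_words_carrier) (simp add: even_words_def)

lemma hamming_dist_ge_min_distance:
  assumes "x \<in> C" "y \<in> C" "x \<noteq> y"
  shows "min_distance C \<le> enat (hamming_dist x y)"
  unfolding min_distance_def using assms by (intro Inf_lower) auto

text \<open>With two letters, x agrees with y or with z wherever y and z differ, so d(y, z) is at
  most (n - d(x, y)) + (n - d(x, z)). Words far from x are therefore close to each other.\<close>

lemma hamming_dist_two_far:
  assumes "x \<in> carrier_vec n" "y \<in> carrier_vec n" "z \<in> carrier_vec n"
  shows "hamming_dist y z + hamming_dist x y + hamming_dist x z \<le> 2 * n"
proof -
  let ?D = "\<lambda>x y :: bit vec. {i. i < n \<and> x $ i \<noteq> y $ i}"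
  have sub: "?D u v \<subseteq> {..<n}" for u v
    by auto
  have compl: "card ({..<n} - ?D u v) = n - card (?D u v)" "card (?D u v) \<le> n" for u v
    using card_mono[OF finite_lessThan sub] card_Diff_subset[OF finite_subset[OF sub] sub, of u v]
    by simp_all
  have "a = b \<or> a = c \<or> b = c" for a b c :: bit
    by (cases a; cases b; cases c) auto
  then have "?D y z \<subseteq> ({..<n} - ?D x y) \<union> ({..<n} - ?D x z)"
    by fastforce
  then have "card (?D y z) \<le> card (({..<n} - ?D x y) \<union> ({..<n} - ?D x z))"
    by (intro card_mono) auto
  also have "\<dots> \<le> (n - card (?D x y)) + (n - card (?D x z))"
    using card_Un_le[of "{..<n} - ?D x y" "{..<n} - ?D x z"] by (simp add: compl)
  finally show ?thesis
    using assms compl(2)[of x y] compl(2)[of x z] by (simp add: hamming_dist_def)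
qed

text \<open>The character at coordinate \<open>i\<close>; the positions \<open>i \<ge> dim_vec x\<close> carry the trivial character.\<close>

definition character :: "bit vec \<Rightarrow> nat \<Rightarrow> int" where
  "character x i = (if i < dim_vec x \<and> x $ i \<noteq> 0 then - 1 else 1)"

text \<open>The product is 1 where the words agree and -1 where they differ; the padding positions
  from n to m count as agreements.\<close>

lemma sum_character_mult:
  assumes "x \<in> carrier_vec n" "y \<in> carrier_vec n" "n \<le> m"
  shows "(\<Sum>i<m. character x i * character y i) = int m - 2 * int (hamming_dist x y)"
proof -
  have "(\<Sum>i<m. character x i * character y i)
      = (\<Sum>i<m. 1 - 2 * of_bool (i < n \<and> x $ i \<noteq> y $ i))"
    using assms by (intro sum.cong) (auto simp: character_def)
  also have "\<dots> = int m - 2 * (\<Sum>i<m. of_bool (i < n \<and> x $ i \<noteq> y $ i))"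
    by (simp add: sum_subtractf sum_distrib_left)
  also have "(\<Sum>i<m. of_bool (i < n \<and> x $ i \<noteq> y $ i))
      = int (card {i \<in> {..<m}. i < n \<and> x $ i \<noteq> y $ i})"
    by (simp add: Int_def)
  also have "{i \<in> {..<m}. i < n \<and> x $ i \<noteq> y $ i} = {i. i < n \<and> x $ i \<noteq> y $ i}"
    using assms by auto
  finally show ?thesis
    using assms by (simp add: hamming_dist_def)
qed

text \<open>For odd \<open>card D\<close> each of the \<open>m * (m - 1)\<close> off-diagonal character sums is odd, so its square is
  at least 1; the diagonal ones are equal to \<open>card D\<close>.\<close>

lemma sum_square_distance_ge:
  assumes D: "finite D" "D \<subseteq> carrier_vec n" "odd (card D)" and "n \<le> m"
  shows "int m * int (card D) ^ 2 + int m * (int m - 1)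
    \<le> (\<Sum>x\<in>D. \<Sum>y\<in>D. (int m - 2 * int (hamming_dist x y)) ^ 2)"
proof -
  \<comment> \<open>Correlation of the coordinates i and j over the code. The sum of all its squares
    is computed a second time from pairs of words.\<close>
  define S where "S i j = (\<Sum>x\<in>D. character x i * character x j)" for i j
  have diag: "S i i = int (card D)" for i
    unfolding S_def by (simp add: character_def if_distrib cong: if_cong)
  have "odd (character x i * character x j)" for x i j
    by (simp add: character_def)
  then have "odd (S i j)" for i j
    using D unfolding S_def by (subst even_sum_iff) auto
  then have "S i j \<noteq> 0" for i j
    by (metis even_zero)
  then have S: "(S i j)\<^sup>2 \<ge> 1" for i j
    by (metis int_one_le_iff_zero_less zero_less_power2)
  have row: "int (card D) ^ 2 + (int m - 1) \<le> (\<Sum>j<m. (S i j)\<^sup>2)" if "i < m" for i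
  proof -
    have "(\<Sum>j\<in>{..<m} - {i}. 1 :: int) \<le> (\<Sum>j\<in>{..<m} - {i}. (S i j)\<^sup>2)"
      by (intro sum_mono S)
    moreover have "(\<Sum>j<m. (S i j)\<^sup>2) = (S i i)\<^sup>2 + (\<Sum>j\<in>{..<m} - {i}. (S i j)\<^sup>2)"
      using that by (intro sum.remove) auto
    ultimately show ?thesis
      using that by (simp add: diag of_nat_diff)
  qed
  have "int m * int (card D) ^ 2 + int m * (int m - 1)
      = (\<Sum>i<m. int (card D) ^ 2 + (int m - 1))"
    by (simp add: algebra_simps)
  also have "\<dots> \<le> (\<Sum>i<m. \<Sum>j<m. (S i j)\<^sup>2)"
    using row by (intro sum_mono) auto
  \<comment> \<open>Expanding the squares and moving the word sums outside turns coordinate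
    correlations into word correlations: the two Gram matrices of the character table have the same
    Frobenius norm.\<close>
  also have "\<dots> = (\<Sum>i<m. \<Sum>j<m. \<Sum>x\<in>D. \<Sum>y\<in>D.
      (character x i * character y i) * (character x j * character y j))"
    by (simp add: S_def power2_eq_square sum_product mult_ac)
  also have "\<dots> = (\<Sum>i<m. \<Sum>x\<in>D. \<Sum>j<m. \<Sum>y\<in>D.
      (character x i * character y i) * (character x j * character y j))"
    by (intro sum.cong refl sum.swap)
  also have "\<dots> = (\<Sum>i<m. \<Sum>x\<in>D. \<Sum>y\<in>D. \<Sum>j<m.
      (character x i * character y i) * (character x j * character y j))"
    by (intro sum.cong refl sum.swap)
  also have "\<dots> = (\<Sum>x\<in>D. \<Sum>i<m. \<Sum>y\<in>D. \<Sum>j<m.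
      (character x i * character y i) * (character x j * character y j))"
    by (rule sum.swap)
  also have "\<dots> = (\<Sum>x\<in>D. \<Sum>y\<in>D. \<Sum>i<m. \<Sum>j<m.
      (character x i * character y i) * (character x j * character y j))"
    by (intro sum.cong refl sum.swap)
  also have "\<dots> = (\<Sum>x\<in>D. \<Sum>y\<in>D. (\<Sum>i<m. character x i * character y i)\<^sup>2)"
    by (simp add: power2_eq_square sum_product)
  also have "\<dots> = (\<Sum>x\<in>D. \<Sum>y\<in>D. (int m - 2 * int (hamming_dist x y)) ^ 2)"
    using D \<open>n \<le> m\<close> by (intro sum.cong refl arg_cong[where f = "\<lambda>t. t\<^sup>2"] sum_character_mult) auto
  finally show ?thesis .
qed

lemma code_9_card_le:
  assumes C: "C \<subseteq> even_words 9" and dist: "min_distance C \<ge> 4"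
  shows "card C \<le> 20"
proof (rule ccontr)
  assume "\<not> card C \<le> 20"
  then have "21 \<le> card C"
    by simp
  \<comment> \<open>Exactly 21 words are selected because the parity bound needs an odd
    size.\<close>
  then obtain D where D: "D \<subseteq> C" "card D = 21" "finite D"
    by (rule obtain_subset_with_card_n)
  have word: "x \<in> even_words 9" "x \<in> carrier_vec 9" if "x \<in> D" for x
    using that D C even_words_carrier by blast+
  have le9: "hamming_dist x y \<le> 9" if "x \<in> D" for x y
    using card_mono[of "{..<9}" "{i. i < 9 \<and> x $ i \<noteq> y $ i}"] word(2)[OF that]
    by (auto simp: hamming_dist_def)
  have ge4: "hamming_dist x y \<ge> 4" if "x \<in> D" "y \<in> D" "x \<noteq> y" for x y
  proof -
    have "enat 4 \<le> enat (hamming_dist x y)"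
      using order_trans[OF dist hamming_dist_ge_min_distance[of x C y]] that D
      by (auto simp flip: numeral_eq_enat)
    then show ?thesis
      by simp
  qed
  \<comment> \<open>Two words at distance 8 from x would be at distance at most 18 - 16 = 2 from
    each other.\<close>
  have far: "card {y \<in> D. hamming_dist x y = 8} \<le> 1" if "x \<in> D" for x
  proof -
    have "y = z" if "y \<in> D" "z \<in> D" "hamming_dist x y = 8" "hamming_dist x z = 8" for y z
      using hamming_dist_two_far[of x 9 y z] ge4[of y z] that word \<open>x \<in> D\<close> by fastforce
    then show ?thesis
      using D by (simp add: card_le_Suc0_iff_eq)
  qed
  \<comment> \<open>Ten positions place the distances 4 and 6 symmetrically about 5, so both give
    the square 4. Distance 0 gives 100 = 4 + 96, and distance 8 gives 36 = 4 + 32.\<close>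
  have summand: "(10 - 2 * int (hamming_dist x y))\<^sup>2
      \<le> 4 + 96 * of_bool (y = x) + 32 * of_bool (hamming_dist x y = 8)"
    if "x \<in> D" "y \<in> D" for x y
  proof (cases "x = y")
    case True
    then show ?thesis
      by (simp add: hamming_dist_def)
  next
    case False
    have "hamming_dist x y \<in> {4, 6, 8}"
      using ge4[OF that False] le9[OF that(1), of y] even_hamming_dist[of x 9 y] that word
      by simp presburger
    then show ?thesis
      using False by auto
  qed
  \<comment> \<open>The total 212 is 21 * 4 + 96 + 32: the word itself and at most one word at
    distance 8 contribute the extra terms.\<close>
  have row: "(\<Sum>y\<in>D. (10 - 2 * int (hamming_dist x y))\<^sup>2) \<le> 212" if "x \<in> D" for x
  proof -
    have "(\<Sum>y\<in>D. (10 - 2 * int (hamming_dist x y))\<^sup>2)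
        \<le> (\<Sum>y\<in>D. 4 + 96 * of_bool (y = x) + 32 * of_bool (hamming_dist x y = 8))"
      using that by (intro sum_mono summand)
    also have "\<dots> = 84 + 96 * (\<Sum>y\<in>D. of_bool (y = x))
        + 32 * (\<Sum>y\<in>D. of_bool (hamming_dist x y = 8))"
      by (simp only: sum.distrib sum_distrib_left) (simp add: D)
    also have "(\<Sum>y\<in>D. of_bool (y = x)) = (1 :: int)"
      using that D by (simp add: of_bool_def)
    also have "(\<Sum>y\<in>D. of_bool (hamming_dist x y = 8)) = int (card {y \<in> D. hamming_dist x y = 8})"
      using D by (simp add: Int_def)
    finally show ?thesis
      using far[OF that] by simp
  qed
  \<comment> \<open>The left side is 10 * 441 + 90 = 4500, while 21 rows give at most 21 * 212 =
    4452.\<close>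
  have "int 10 * int (card D) ^ 2 + int 10 * (int 10 - 1)
      \<le> (\<Sum>x\<in>D. \<Sum>y\<in>D. (int 10 - 2 * int (hamming_dist x y)) ^ 2)"
    using D word by (intro sum_square_distance_ge[of _ 9]) auto
  also have "\<dots> \<le> (\<Sum>x\<in>D. 212)"
    using row by (intro sum_mono) auto
  finally show False
    using D by simp
qed

section \<open>Partitions into 13 codes\<close>

lemma sum_card_code_partition:
  assumes "code_partition n P"
  shows "finite P" "(\<Sum>C\<in>P. card C) = card (even_words n)"
proof -
  have P: "disjoint P" "\<Union> P = even_words n"
    using assms by (auto simp: code_partition_def)
  show "finite P"
    using P(2) finite_even_words[of n] by (metis finite_UnionD)
  have "finite C" if "C \<in> P" for C
    using that P(2) finite_even_words[of n] by (metis Union_upper finite_subset)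
  then show "(\<Sum>C\<in>P. card C) = card (even_words n)"
    using P card_Union_disjoint[of P] by (simp add: disjoint_def pairwise_def disjnt_def)
qed

text \<open>If C were moved, its image would be a second member with at most 16 words. The other 11
  codes have at most 20 words each, leaving 252 words in place of 256.\<close>

lemma small_code_fixed:
  assumes P: "code_partition 9 P" "card P = 13" "\<And>C. C \<in> P \<Longrightarrow> min_distance C \<ge> 4"
    and C: "C \<in> P" "card C \<le> 16" and g: "g \<in> carrier (aut_family 9 P)"
  shows "g ` C = C"
proof (rule ccontr)
  assume ne: "g ` C \<noteq> C"
  note fin = sum_card_code_partition(1)[OF P(1)]
  have sub: "D \<subseteq> even_words 9" if "D \<in> P" for D
    using P(1) that by (auto simp: code_partition_def)
  have gC: "g ` C \<in> P"
    using g C by (auto simp: aut_family_def)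
  have "card (g ` C) \<le> card C"
    using sub[OF C(1)] finite_even_words finite_subset by (metis card_image_le)
  then have gC_card: "card (g ` C) \<le> 16"
    using C(2) by simp
  have "256 = (\<Sum>D\<in>P. card D)"
    using sum_card_code_partition(2)[OF P(1)] by (simp add: card_even_words)
  also have "\<dots> = card C + (\<Sum>D\<in>P - {C}. card D)"
    using fin C by (simp add: sum.remove)
  also have "\<dots> = card C + (card (g ` C) + (\<Sum>D\<in>P - {C} - {g ` C}. card D))"
    using fin gC ne by (subst sum.remove[of "P - {C}" "g ` C"]) auto
  also have "(\<Sum>D\<in>P - {C} - {g ` C}. card D) \<le> (\<Sum>D\<in>P - {C} - {g ` C}. 20)"
    using P(3) sub by (intro sum_mono code_9_card_le) auto
  also have "(\<Sum>D\<in>P - {C} - {g ` C}. 20) = 20 * (11 :: nat)"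
    using fin gC ne C P(2) by (simp add: card_Diff_subset)
  finally show False
    using C(2) gC_card by simp
qed

text \<open>Without a fixed code p divides 13, hence p = 13 and H is transitive on P. All codes then
  have the same size, which contradicts the number of even words being a power of 2.\<close>

lemma prime_power_subgroup_fixes_code:
  assumes P: "code_partition n P" "n > 0" "card P = 13"
    and H: "subgroup H (aut_family n P)" "card H = p ^ a" and p: "prime p"
  shows "\<exists>C\<in>P. \<forall>g\<in>H. g ` C = C"
proof (rule ccontr)
  assume none: "\<not> (\<exists>C\<in>P. \<forall>g\<in>H. g ` C = C)"
  note fin = sum_card_code_partition(1)[OF P(1)]
  have sub: "\<Union> P \<subseteq> even_words n"
    using P(1) by (simp add: code_partition_def)
  let ?G = "(aut_family n P)\<lparr>carrier := H\<rparr>" and ?\<phi> = "\<lambda>g. \<lambda>C\<in>P. g ` C"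
  interpret group_action ?G P ?\<phi>
    by (rule group_action.induced_action[OF aut_family_action[OF sub] H(1)])
  have order: "Coset.order ?G = p ^ a"
    using H(2) by (simp add: Coset.order_def)
  have "p dvd card P"
    using fixed_point_prime_power[OF p order fin] none by fastforce
  moreover have "prime (13 :: nat)"
    by simp
  ultimately have p13: "p = 13"
    using p P(3) primes_dvd_imp_eq by metis
  obtain C where C: "C \<in> P"
    using P(3) by fastforce
  have "13 dvd card (orbit ?G ?\<phi> C)"
    using card_orbit_prime_power[OF p order C] none C p13 by auto
  moreover have orbit: "orbit ?G ?\<phi> C \<subseteq> P"
    using element_image C by (auto simp: orbit_def)
  moreover have "orbit ?G ?\<phi> C \<noteq> {}"
    using orbit_refl[OF C] by auto
  \<comment> \<open>A nonempty subset of the 13 codes whose size is a multiple of 13 contains all of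
    them.\<close>
  ultimately have "orbit ?G ?\<phi> C = P"
    using fin P(3) by (metis card_gt_0_iff card_subset_eq dvd_imp_le finite_subset card_mono le_antisym)
  \<comment> \<open>Elements of H are injective on words, so codes in one orbit have equal
    size.\<close>
  moreover have "card D = card C" if "D \<in> orbit ?G ?\<phi> C" for D
  proof -
    obtain g where g: "g \<in> H" "D = g ` C"
      using \<open>D \<in> orbit ?G ?\<phi> C\<close> C by (auto simp: orbit_def)
    then have "g \<in> Bij (even_words n)"
      using subgroup.subset[OF H(1)] symmetries_subset_Bij[of n] by (auto simp: aut_family_def)
    then have "inj_on g C"
      using C sub by (auto simp: Bij_def bij_betw_def intro: inj_on_subset)
    with g show ?thesis
      by (simp add: card_image)
  qed
  ultimately have "(\<Sum>D\<in>P. card D) = 13 * card C"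
    using P(3) by simp
  then have "13 dvd (2 :: nat) ^ (n - 1)"
    using sum_card_code_partition(2)[OF P(1)] card_even_words[OF P(2)] by (metis dvd_triv_left)
  then have "13 dvd (2 :: nat)"
    using prime_dvd_power[OF \<open>prime (13 :: nat)\<close>] by blast
  then show False
    by simp
qed

theorem theorem2:
  fixes P :: "bit vec set set"
  assumes "code_partition 9 P"
    and "card P = 13"
    and "\<And>C. C \<in> P \<Longrightarrow> min_distance C \<ge> 4"
  shows "(\<forall>C \<in> P. (\<exists>D. is_doubly_extended_hamming D \<and> equivalent_codes 9 D C)
            \<and> Coset.order (aut_family 9 P) \<ge> 2 \<longrightarrow>
          (\<exists>H. subgroup H (aut_family 9 P) \<and> prime (card H) \<and> subgroup H (aut_code 9 C)))
    \<and> (Coset.order (aut_family 9 P) \<ge> 3 \<longrightarrow>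
          (\<exists>H. subgroup H (aut_family 9 P) \<and> (card H = 4 \<or> prime (card H) \<and> odd (card H))
            \<and> (\<exists>C \<in> P. subgroup H (aut_code 9 C))))"
proof (intro conjI ballI impI)
  have sub: "\<Union> P \<subseteq> even_words 9"
    using assms(1) by (simp add: code_partition_def)
  let ?A = "aut_family 9 P"
  \<comment> \<open>Every prime power dividing the order is the order of a subgroup; the exponent 1
    is Cauchy's theorem.\<close>
  have sylow: "\<exists>H. subgroup H ?A \<and> card H = p ^ a"
    if "prime p" "p ^ a dvd Coset.order ?A" "Coset.order ?A \<ge> 2" for p a
  proof -
    \<comment> \<open>\<open>Coset.order\<close> is 0 for an infinite carrier, so a positive order
      ensures finiteness.\<close>
    have "finite (carrier ?A)"
      using that(3) by (intro card_ge_0_finite) (simp add: Coset.order_def)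
    with that show ?thesis
      using sylow_thm[OF that(1) group_aut_family[OF sub]] by (auto simp: dvd_def)
  qed
  {
    fix C
    assume C: "C \<in> P"
      and *: "(\<exists>D. is_doubly_extended_hamming D \<and> equivalent_codes 9 D C) \<and> Coset.order ?A \<ge> 2"
    then obtain D g where D: "is_doubly_extended_hamming D" "C = g ` D"
      by (auto simp: equivalent_codes_def)
    have C16: "card C \<le> 16"
      using doubly_extended_hamming_card_le[OF D(1)] D(2) by (metis card_image_le le_trans)
    obtain p where p: "prime p" "p dvd Coset.order ?A"
      using * prime_factor_nat[of "Coset.order ?A"] by auto
    then obtain H where H: "subgroup H ?A" "card H = p"
      using sylow[of p 1] * by auto
    \<comment> \<open>Every automorphism of the partition fixes this small code, so any subgroup of
      prime order serves.\<close>
    have "g ` C = C" if "g \<in> H" for g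
      using small_code_fixed[OF assms C C16] subgroup.subset[OF H(1)] that by auto
    then have "subgroup H (aut_code 9 C)"
      by (rule subgroup_aut_codeI[OF sub C H(1)])
    with H p show "\<exists>H. subgroup H ?A \<and> prime (card H) \<and> subgroup H (aut_code 9 C)"
      by auto
  }
  assume ord: "Coset.order ?A \<ge> 3"
  \<comment> \<open>The order is also recorded as a prime power, the form required for finding a
    fixed code; 4 enters as 2^2.\<close>
  have "\<exists>p a H. prime p \<and> subgroup H ?A \<and> card H = p ^ a
      \<and> (card H = 4 \<or> prime (card H) \<and> odd (card H))"
    using four_or_odd_prime_dvd[OF ord]
  proof
    assume "4 dvd Coset.order ?A"
    then obtain H where "subgroup H ?A" "card H = 2 ^ 2"
      using sylow[of 2 2] ord by auto
    then show ?thesis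
      by (intro exI[of _ 2] exI[of _ H]) auto
  next
    assume "\<exists>p. prime p \<and> odd p \<and> p dvd Coset.order ?A"
    then obtain p where p: "prime p" "odd p" "p dvd Coset.order ?A"
      by blast
    then obtain H where "subgroup H ?A" "card H = p ^ 1"
      using sylow[of p 1] ord by auto
    with p show ?thesis
      by (intro exI[of _ p] exI[of _ 1] exI[of _ H]) auto
  qed
  then obtain p a H where H: "prime p" "subgroup H ?A" "card H = p ^ a"
    "card H = 4 \<or> prime (card H) \<and> odd (card H)"
    by blast
  obtain C where "C \<in> P" "\<forall>g\<in>H. g ` C = C"
    using prime_power_subgroup_fixes_code[OF assms(1) _ assms(2) H(2,3,1)] by auto
  then have "C \<in> P" "subgroup H (aut_code 9 C)"
    using subgroup_aut_codeI[OF sub _ H(2)] by auto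
  with H show "\<exists>H. subgroup H ?A \<and> (card H = 4 \<or> prime (card H) \<and> odd (card H))
      \<and> (\<exists>C\<in>P. subgroup H (aut_code 9 C))"
    by blast
qed

end
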